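(* Let $x_1,\ldots,x_m$ be continuous, independent and identically distributed random variables in the unit ball $\Omega_n\subset\mathbb{R}^n$ with probability density function $f\in C^\infty_0(\Omega_n)$. Let $$g_m(s,y)=\frac{1}{m}\,\#\{i\in\{1,\ldots,m\} : |x_i-y|^2\le s^2\},\qquad s\in\mathbb{R}^+,\ y\in\mathbb{R}^n,$$ be the approximation to the spherical Radon transform $g=R_Mf$. Then for any finite set $\{y_j\}_{j=1}^K\subset\mathbb{R}^n$ of sphere centers and any $0\le p\le 1$, with probability at least $1-p$, $$\frac{1}{K}\sum_{j=1}^K\|g_{y_j}-g_{m,y_j}\|^2_{L^2(\mathbb{R}^+)}\le\frac{1}{m}\left(\log(K)+\log\left(\frac{2}{p}\right)\right),$$ where $g_{y_j}(s)=g(s,y_j)$ and $g_{m,y_j}(s)=g_m(s,y_j)$.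
   Context: $\Omega_n$ is the unit ball of $\mathbb{R}^n$; $C^\infty_0(\Omega_n)$ is the space of smooth functions compactly supported on $\Omega_n$. The spherical (volumetric) Radon transform of $f$ is $$R_Mf(s,y)=\int_0^s r^{n-1}\int_{S^{n-1}}f(y+r\theta)\,\mathrm{d}\theta\,\mathrm{d}r,\qquad s\in\mathbb{R}^+,\ y\in\mathbb{R}^n,$$ i.e. the integral of $f$ over the ball of radius $s$ centered at $y$. The centers $y_j$ are fixed (deterministic). For $p=0$ the right-hand side is read as $+\infty$. *)

theory Defs
  imports "HOL-Probability.Probability"
begin

primrec C_k :: "nat \<Rightarrow> (real ^ 'n \<Rightarrow> real) \<Rightarrow> bool" where
  "C_k 0 f \<longleftrightarrow> continuous_on UNIV f"
| "C_k (Suc k) f \<longleftrightarrow>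
     (\<exists>f'. (\<forall>x. (f has_derivative f' x) (at x)) \<and> (\<forall>v. C_k k (\<lambda>x. f' x v)))"

text \<open>An element of \<open>C\<^sub>0\<^sup>\<infinity>(\<Omega>)\<close> is identified with its extension by zero
  to the whole space; the support is the closure of the set where the function is nonzero.\<close>

definition smooth_compact_support_in :: "(real ^ 'n \<Rightarrow> real) \<Rightarrow> (real ^ 'n) set \<Rightarrow> bool" where
  "smooth_compact_support_in f U \<longleftrightarrow>
     (\<forall>k. C_k k f) \<and> compact (closure {x. f x \<noteq> 0}) \<and> closure {x. f x \<noteq> 0} \<subseteq> U"

text \<open>Surface measure on the unit sphere \<open>S\<^sup>n\<^sup>-\<^sup>1\<close> as cone measure: a Borel set \<open>A\<close> of the
  sphere gets \<open>n\<close> times the volume of the cone \<open>{r \<theta> | 0 < r \<le> 1, \<theta> \<in> A}\<close>.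
  Here \<open>sgn x = x / |x|\<close>. For \<open>n = 1\<close> this is the counting measure on \<open>{-1, 1}\<close>.\<close>

definition sphere_measure :: "(real ^ 'n) measure" where
  "sphere_measure =
     scale_measure (of_nat CARD('n))
       (distr (restrict_space lborel (cball 0 1 - {0})) (restrict_space borel (sphere 0 1)) sgn)"

definition spherical_Radon :: "(real ^ 'n \<Rightarrow> real) \<Rightarrow> real \<Rightarrow> real ^ 'n \<Rightarrow> real" where
  "spherical_Radon f s y =
     (LBINT r:{0..s}. r ^ (CARD('n) - 1) * (LINT \<theta>|sphere_measure. f (y + r *\<^sub>R \<theta>)))"

definition empirical_Radon :: "nat \<Rightarrow> (nat \<Rightarrow> real ^ 'n) \<Rightarrow> real \<Rightarrow> real ^ 'n \<Rightarrow> real" where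
  "empirical_Radon m x s y = 1 / real m * real (card {i \<in> {1..m}. (norm (x i - y))\<^sup>2 \<le> s\<^sup>2})"

text \<open>Squared norm in \<open>L\<^sup>2(\<real>\<^sup>+)\<close>, with value \<open>\<infinity>\<close> for functions that are not
  square-integrable.\<close>

definition L2_pos_norm_sq :: "(real \<Rightarrow> real) \<Rightarrow> ennreal" where
  "L2_pos_norm_sq h = (\<integral>\<^sup>+ s \<in> {0<..}. ennreal ((h s)\<^sup>2) \<partial>lborel)"

lemma sgn_measurable_sphere:
  "sgn \<in> restrict_space lborel (cball 0 1 - {0 :: real ^ 'n})
           \<rightarrow>\<^sub>M restrict_space borel (sphere 0 1)"
proof (rule measurable_restrict_space2)
  show "sgn \<in> space (restrict_space lborel (cball 0 1 - {0 :: real ^ 'n})) \<rightarrow> sphere 0 1"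
    by (auto simp: space_restrict_space norm_sgn)
  have "(sgn :: real ^ 'n \<Rightarrow> real ^ 'n) \<in> borel_measurable borel"
    unfolding sgn_div_norm by measurable
  then show "sgn \<in> borel_measurable (restrict_space lborel (cball 0 1 - {0 :: real ^ 'n}))"
    by (intro measurable_restrict_space1) simp
qed

lemma emeasure_sphere_measure:
  assumes "A \<in> sets borel" "A \<subseteq> sphere (0 :: real ^ 'n) 1"
  shows "emeasure sphere_measure A =
           of_nat CARD('n) * emeasure lborel {r *\<^sub>R \<theta> | r \<theta>. 0 < r \<and> r \<le> 1 \<and> \<theta> \<in> A}"
proof -
  have A: "A \<in> sets (restrict_space borel (sphere (0 :: real ^ 'n) 1))"
    using assms by (simp add: sets_restrict_space_iff)
  have eq: "sgn -` A \<inter> (cball 0 1 - {0}) = {r *\<^sub>R \<theta> | r \<theta>. 0 < r \<and> r \<le> 1 \<and> \<theta> \<in> A}"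
  proof (intro set_eqI iffI)
    fix x assume "x \<in> sgn -` A \<inter> (cball 0 1 - {0})"
    then show "x \<in> {r *\<^sub>R \<theta> | r \<theta>. 0 < r \<and> r \<le> 1 \<and> \<theta> \<in> A}"
      by (intro CollectI exI[of _ "norm x"] exI[of _ "sgn x"]) (auto simp: sgn_div_norm)
  next
    fix x assume "x \<in> {r *\<^sub>R \<theta> | r \<theta>. 0 < r \<and> r \<le> 1 \<and> \<theta> \<in> A}"
    then obtain r \<theta> where "x = r *\<^sub>R \<theta>" "0 < r" "r \<le> 1" "\<theta> \<in> A" by blast
    moreover from this assms have "norm \<theta> = 1" by auto
    ultimately show "x \<in> sgn -` A \<inter> (cball 0 1 - {0})"
      by (auto simp: sgn_div_norm)
  qed
  have "emeasure sphere_measure A = of_nat CARD('n) *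
      emeasure (restrict_space lborel (cball 0 1 - {0 :: real ^ 'n})) (sgn -` A \<inter> (cball 0 1 - {0}))"
    unfolding sphere_measure_def emeasure_scale_measure
    by (subst emeasure_distr[OF sgn_measurable_sphere A]) (simp add: space_restrict_space)
  also have "\<dots> = of_nat CARD('n) * emeasure lborel (sgn -` A \<inter> (cball 0 1 - {0}))"
    by (subst emeasure_restrict_space) auto
  finally show ?thesis by (simp only: eq)
qed

end

theory Submission
  imports Defs
begin

text \<open>
For a probability density \<open>f\<close>, the spherical Radon transform at \<open>(s, y)\<close> is the probability of the ball
of radius \<open>s\<close> around \<open>y\<close>; this is integration in polar coordinates
(\<open>nn_integral_polar\<close>, \<open>spherical_Radon_eq_nn_integral\<close>).  So \<open>g\<^sub>y\<close> is the distribution function of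
the distance \<open>\<bar>x - y\<bar>\<close>, and the empirical transform is the empirical distribution function.

The \<open>L\<^sup>2\<close> distance of the two could be bounded through the uniform distance and the
Dvoretzky-Kiefer-Wolfowitz inequality with its sharp constant.  It is easier to regard the
deviation as an average of independent centred random elements of the Hilbert space
\<open>L\<^sup>2\<close> and to prove a Hoeffding inequality there, which gives the same constant.  If \<open>W\<^sub>1, \<dots>, W\<^sub>m\<close> are
independent, identically distributed and take values in the ball of radius \<open>r\<close> around the
origin, then their centred sum \<open>S\<close> satisfies
\[ P (\|S\| \ge t) \le 2 \exp (- t^2 / (2 m r^2)) \]
(\<open>L2_hoeffding\<close>).  The heart of the matter is that one summand increases the expectation of
\<open>cosh \<parallel>S\<parallel>\<close> by a factor of at most \<open>exp (r\<^sup>2 / 2)\<close> even when the mean of \<open>W\<^sub>i\<close> is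
not the centre of the ball (\<open>cosh_L2_step\<close>).  Indicators of half lines, shifted by \<open>1/2\<close>,
restricted to an interval of length 2 have norm \<open>r\<close> with \<open>r\<^sup>2 = 1/2\<close>, and the distances from
\<open>y\<close> to points of the unit ball lie in such an interval.  This gives the tail bound
\<open>2 exp (- t)\<close> for \<open>\<parallel>g\<^sub>y - g\<^sub>m\<^sub>,\<^sub>y\<parallel>\<^sup>2 > t / m\<close> (\<open>L2_deviation_tail\<close>).  With
\<open>t = ln K + ln (2 / p)\<close> each of the \<open>K\<close> centres fails with probability at most \<open>p / K\<close>, and
the union bound finishes the proof.
\<close>

section \<open>A Hoeffding lemma for the hyperbolic cosine\<close>

lemma cosh_sqrt_sums:
  fixes u :: real
  assumes "u \<ge> 0"
  shows "(\<lambda>k. u ^ k / fact (2 * k)) sums cosh (sqrt u)"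
proof -
  have "(\<lambda>k. if even (2 * k) then sqrt u ^ (2 * k) /\<^sub>R fact (2 * k) else 0) sums cosh (sqrt u)"
    by (subst sums_mono_reindex[of "\<lambda>k. 2 * k"])
       (auto simp: strict_mono_def elim!: evenE intro: cosh_converges)
  moreover have "sqrt u ^ (2 * k) = u ^ k" for k
    using assms by (simp add: power_mult)
  ultimately show ?thesis
    by (simp add: divide_inverse mult.commute)
qed

text \<open>Every coefficient of the power series \<open>\<Sum>k. u ^ k / (2 k)!\<close> is nonnegative, so the function is
a limit of nonnegative combinations of the convex functions \<open>u ^ k\<close>.  This makes
\<open>cosh \<parallel>v + w\<parallel>\<close> a convex function of \<open>\<parallel>v + w\<parallel>\<^sup>2\<close>, and so of \<open>\<langle>v, w\<rangle>\<close> when the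
norms of \<open>v\<close> and \<open>w\<close> are fixed.\<close>

lemma convex_on_cosh_sqrt: "convex_on {0..} (\<lambda>u::real. cosh (sqrt u))"
proof (rule convex_onI)
  fix t x y :: real
  assume t: "0 < t" "t < 1" and xy: "x \<in> {0..}" "y \<in> {0..}"
  define z where "z = (1 - t) *\<^sub>R x + t *\<^sub>R y"
  have "z \<ge> 0" unfolding z_def using t xy by auto
  have "z ^ k / fact (2 * k) \<le> (1 - t) * (x ^ k / fact (2 * k)) + t * (y ^ k / fact (2 * k))" for k
  proof -
    have "convex_on {0::real..} (\<lambda>u. u ^ k)"
      by (cases "even k") (auto intro: convex_power_odd convex_on_subset[OF convex_power_even])
    from convex_onD[OF this, of t x y] t xy have "z ^ k \<le> (1 - t) * x ^ k + t * y ^ k"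
      by (simp add: z_def)
    then have "z ^ k / fact (2 * k) \<le> ((1 - t) * x ^ k + t * y ^ k) / fact (2 * k)"
      by (rule divide_right_mono) simp
    then show ?thesis by (simp add: add_divide_distrib)
  qed
  then show "cosh (sqrt z) \<le> (1 - t) * cosh (sqrt x) + t * cosh (sqrt y)"
  proof (rule sums_le)
    show "(\<lambda>k. (1 - t) * (x ^ k / fact (2 * k)) + t * (y ^ k / fact (2 * k)))
        sums ((1 - t) * cosh (sqrt x) + t * cosh (sqrt y))"
      using xy by (intro sums_add sums_mult cosh_sqrt_sums) auto
  qed (rule cosh_sqrt_sums[OF \<open>z \<ge> 0\<close>])
qed (simp add: convex_real_interval)

text \<open>If \<open>a = \<parallel>v\<parallel>\<close>, \<open>r = \<parallel>w\<parallel>\<close> and \<open>b = \<langle>v, w\<rangle>\<close>, the left-hand side is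
\<open>cosh \<parallel>v + w\<parallel>\<close>.  By convexity it lies below its chord over the interval
\<open>\<bar>b\<bar> \<le> a r\<close> that Cauchy-Schwarz allows; at the end points \<open>w\<close> is parallel to \<open>v\<close> and the
value is \<open>cosh (a \<plusminus> r)\<close>.  The bound is affine in \<open>b\<close>, so its expectation depends on
the mean of \<open>b\<close> alone.\<close>

lemma cosh_sqrt_chord:
  fixes a b r :: real
  assumes "a > 0" "r > 0" "\<bar>b\<bar> \<le> a * r"
  shows "cosh (sqrt (a\<^sup>2 + 2 * b + r\<^sup>2)) \<le> cosh a * cosh r + b / (a * r) * (sinh a * sinh r)"
proof -
  define u :: real where "u = b / (a * r)"
  \<comment> \<open>The weight of the end point \<open>b = a r\<close>.\<close>
  define t :: real where "t = (1 + u) / 2"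
  have ar: "a * r > 0" using assms by simp
  have "u \<le> 1" "- 1 \<le> u"
    unfolding u_def using assms ar by (auto simp: pos_divide_le_eq pos_le_divide_eq)
  then have t: "0 \<le> t" "t \<le> 1" by (simp_all add: t_def)
  have b: "b = a * r * (2 * t - 1)" unfolding t_def u_def using assms by (simp add: field_simps)
  have comb: "a\<^sup>2 + 2 * b + r\<^sup>2 = (1 - t) *\<^sub>R (a - r)\<^sup>2 + t *\<^sub>R (a + r)\<^sup>2"
    by (simp add: b power2_eq_square algebra_simps)
  have "cosh (sqrt (a\<^sup>2 + 2 * b + r\<^sup>2)) \<le> (1 - t) * cosh (sqrt ((a - r)\<^sup>2)) + t * cosh (sqrt ((a + r)\<^sup>2))"
    unfolding comb by (rule convex_onD[OF convex_on_cosh_sqrt]) (use t in auto)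
  also have "\<dots> = (1 - t) * cosh (a - r) + t * cosh (a + r)"
    by simp
  also have "\<dots> = cosh a * cosh r + (2 * t - 1) * (sinh a * sinh r)"
    by (simp add: cosh_add cosh_diff algebra_simps)
  also have "2 * t - 1 = u" by (simp add: t_def field_simps)
  finally show ?thesis by (simp only: u_def)
qed

text \<open>The left-hand side is the moment generating function at 1 of a variable with values
\<open>r\<close> and \<open>-r\<close> and mean \<open>e\<close>, so this is Hoeffding's lemma for a two-point variable of range
\<open>2 r\<close>.  The centre of the interval \<open>[-r, r]\<close> need not be the mean, and still the exponent is
\<open>r\<^sup>2 / 2\<close>.\<close>

lemma cosh_add_sinh_le_exp:
  fixes e r :: real
  assumes "r > 0" "\<bar>e\<bar> \<le> r"
  shows "cosh r + e / r * sinh r \<le> exp (e + r\<^sup>2 / 2)"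
proof -
  define u :: real where "u = e / r"
  \<comment> \<open>The probability of the value \<open>r\<close>.\<close>
  define q :: real where "q = (1 + u) / 2"
  have "- 1 \<le> u" unfolding u_def using assms by (auto simp: pos_le_divide_eq)
  then have q: "0 \<le> q" by (simp add: q_def)
  have pos: "0 < 1 + q * (exp (2 * r) - 1)"
    using q assms by (intro add_pos_nonneg mult_nonneg_nonneg) auto
  have "- (2 * r) * q + ln (1 + q * (exp (2 * r) - 1)) \<le> (2 * r)\<^sup>2 / 8"
    by (rule Hoeffdings_lemma_aux) (use assms q in auto)
  moreover have "2 * r * q = e + r" using assms by (simp add: q_def u_def field_simps)
  ultimately have "ln (1 + q * (exp (2 * r) - 1)) \<le> e + r + r\<^sup>2 / 2"
    by (simp add: power2_eq_square)
  then have "1 + q * (exp (2 * r) - 1) \<le> exp (e + r + r\<^sup>2 / 2)"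
    using pos by (metis exp_le_cancel_iff exp_ln)
  then have "exp (- r) * (1 + q * (exp (2 * r) - 1)) \<le> exp (- r) * exp (e + r + r\<^sup>2 / 2)"
    by (rule mult_left_mono) simp
  also have "\<dots> = exp (e + r\<^sup>2 / 2)" by (simp flip: exp_add)
  also have "exp (- r) * (1 + q * (exp (2 * r) - 1)) = exp (- r) + q * (exp (- r) * exp (2 * r) - exp (- r))"
    by (simp add: algebra_simps)
  also have "exp (- r) * exp (2 * r) = exp r" by (simp flip: exp_add)
  also have "exp (- r) + q * (exp r - exp (- r)) = cosh r + u * sinh r"
    by (simp add: q_def cosh_field_def sinh_field_def field_simps)
  finally show ?thesis by (simp only: u_def)
qed

text \<open>The left-hand side is the expectation of \<open>cosh (a + V)\<close> for the two-point variable \<open>V\<close> of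
the preceding lemma: add that lemma for \<open>V\<close> and for \<open>-V\<close>.\<close>

lemma cosh_sinh_le_cosh_exp:
  fixes a e r :: real
  assumes "r > 0" "\<bar>e\<bar> \<le> r"
  shows "cosh a * cosh r + e / r * (sinh a * sinh r) \<le> cosh (a + e) * exp (r\<^sup>2 / 2)"
proof -
  define s where "s = e / r"
  have "cosh a * cosh r + s * (sinh a * sinh r)
      = (exp a * (cosh r + s * sinh r) + exp (- a) * (cosh r + (- s) * sinh r)) / 2"
    by (simp add: cosh_field_def[of a] sinh_field_def[of a] field_simps)
  then have "cosh a * cosh r + e / r * (sinh a * sinh r)
      = (exp a * (cosh r + e / r * sinh r) + exp (- a) * (cosh r + (- e) / r * sinh r)) / 2"
    by (simp add: s_def)
  also have "\<dots> \<le> (exp a * exp (e + r\<^sup>2 / 2) + exp (- a) * exp (- e + r\<^sup>2 / 2)) / 2"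
    using assms by (intro divide_right_mono add_mono mult_left_mono cosh_add_sinh_le_exp) auto
  also have "\<dots> = cosh (a + e) * exp (r\<^sup>2 / 2)"
    by (simp add: cosh_field_def algebra_simps flip: exp_add)
  finally show ?thesis .
qed

lemma cosh_mono_abs: 
  fixes x y :: real
  assumes "\<bar>x\<bar> \<le> y"
  shows "cosh x \<le> cosh y"
  using assms cosh_real_nonneg_le_iff[of "\<bar>x\<bar>" y] by (simp add: abs_if split: if_splits)

section \<open>Hoeffding's inequality in \<open>L\<^sup>2\<close>\<close>

lemma integral_cauchy_schwarz:
  fixes f g :: "'a \<Rightarrow> real"
  assumes [simp]: "integrable M (\<lambda>x. (f x)\<^sup>2)" "integrable M (\<lambda>x. (g x)\<^sup>2)" "integrable M (\<lambda>x. f x * g x)"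
  shows "(LINT x|M. f x * g x)\<^sup>2 \<le> (LINT x|M. (f x)\<^sup>2) * (LINT x|M. (g x)\<^sup>2)"
proof -
  define A B C where "A = (LINT x|M. (f x)\<^sup>2)" and "B = (LINT x|M. (g x)\<^sup>2)"
    and "C = (LINT x|M. f x * g x)"
  have q: "0 \<le> t\<^sup>2 * A - 2 * t * C + B" for t
  proof -
    have "0 \<le> (LINT x|M. (t * f x - g x)\<^sup>2)" by simp
    also have "\<dots> = (LINT x|M. t\<^sup>2 * (f x)\<^sup>2 - 2 * t * (f x * g x) + (g x)\<^sup>2)"
      by (rule Bochner_Integration.integral_cong) (simp_all add: power2_eq_square algebra_simps)
    also have "\<dots> = t\<^sup>2 * A - 2 * t * C + B" by (simp add: A_def B_def C_def)
    finally show ?thesis .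
  qed
  have "A \<ge> 0" by (simp add: A_def)
  show ?thesis unfolding A_def[symmetric] B_def[symmetric] C_def[symmetric]
  proof (cases "A = 0")
    case True
    have "C = 0"
    proof (rule ccontr)
      assume "C \<noteq> 0"
      \<comment> \<open>A degenerate quadratic form cannot have a linear term: it would be \<open>-1\<close> here.\<close>
      with q[of "(B + 1) / (2 * C)"] True show False by simp
    qed
    with True show "C\<^sup>2 \<le> A * B" by simp
  next
    case False
    with q[of "C / A"] \<open>A \<ge> 0\<close> show "C\<^sup>2 \<le> A * B"
      by (simp add: field_simps power2_eq_square)
  qed
qed

text \<open>A random element \<open>W x\<close>, with \<open>x\<close> distributed according to \<open>P\<close>, of the ball of radius \<open>r\<close>
around the origin of \<open>L\<^sup>2(N)\<close>.  Elements of \<open>L\<^sup>2(N)\<close> are represented by genuine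
bounded functions, not by classes; inner products and the mean are then plain integrals
that Fubini's theorem relates to each other.\<close>

locale bounded_random_function = P: prob_space P + N: finite_measure N
  for P :: "'a measure" and N :: "'b measure" +
  fixes W :: "'a \<Rightarrow> 'b \<Rightarrow> real" and C r :: real
  assumes W_measurable [measurable]: "case_prod W \<in> borel_measurable (P \<Otimes>\<^sub>M N)"
    and W_bound: "\<bar>W x s\<bar> \<le> C"
    and W_norm: "x \<in> space P \<Longrightarrow> (LINT s|N. (W x s)\<^sup>2) \<le> r\<^sup>2"
    and r_pos: "r > 0"
begin

definition mean :: "'b \<Rightarrow> real" where
  "mean s = (LINT x|P. W x s)"

definition L2 :: "('b \<Rightarrow> real) \<Rightarrow> real" where
  "L2 h = sqrt (LINT s|N. (h s)\<^sup>2)"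

lemma L2_nonneg [simp]: "L2 h \<ge> 0"
  by (simp add: L2_def)

lemma L2_sq: "(L2 h)\<^sup>2 = (LINT s|N. (h s)\<^sup>2)"
  by (simp add: L2_def)

lemma mean_measurable [measurable]: "mean \<in> borel_measurable N"
  unfolding mean_def by measurable

lemma C_nonneg: "C \<ge> 0"
  using W_bound[of undefined undefined] by linarith

lemma mean_bound: "s \<in> space N \<Longrightarrow> \<bar>mean s\<bar> \<le> C"
proof -
  assume [simp]: "s \<in> space N"
  have i: "integrable P (\<lambda>x. W x s)"
    by (rule P.integrable_const_bound[of _ C]) (auto simp: W_bound)
  have "\<bar>mean s\<bar> \<le> (LINT x|P. \<bar>W x s\<bar>)"
    unfolding mean_def by (rule integral_abs_bound)
  also have "\<dots> \<le> (LINT x|P. C)"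
    using i by (intro integral_mono) (auto simp: W_bound)
  finally show ?thesis by (simp add: P.prob_space)
qed

definition bounded_meas :: "('b \<Rightarrow> real) \<Rightarrow> bool" where
  "bounded_meas h \<longleftrightarrow> h \<in> borel_measurable N \<and> (\<exists>D. \<forall>s\<in>space N. \<bar>h s\<bar> \<le> D)"

lemma bounded_meas_measurable [measurable_dest]: "bounded_meas h \<Longrightarrow> h \<in> borel_measurable N"
  by (simp add: bounded_meas_def)

lemma bounded_meas_add: 
  assumes "bounded_meas g" "bounded_meas h"
  shows "bounded_meas (\<lambda>s. g s + h s)"
proof -
  note [measurable] = assms[THEN bounded_meas_measurable]
  obtain D E where "\<forall>s\<in>space N. \<bar>g s\<bar> \<le> D" "\<forall>s\<in>space N. \<bar>h s\<bar> \<le> E"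
    using assms unfolding bounded_meas_def by auto
  then have "\<forall>s\<in>space N. \<bar>g s + h s\<bar> \<le> D + E" by (meson abs_triangle_ineq add_mono order_trans)
  then show ?thesis unfolding bounded_meas_def by auto
qed

lemma bounded_meas_mult: 
  assumes "bounded_meas g" "bounded_meas h"
  shows "bounded_meas (\<lambda>s. g s * h s)"
proof -
  note [measurable] = assms[THEN bounded_meas_measurable]
  obtain D E where DE: "\<forall>s\<in>space N. \<bar>g s\<bar> \<le> D" "\<forall>s\<in>space N. \<bar>h s\<bar> \<le> E"
    using assms unfolding bounded_meas_def by auto
  have "\<forall>s\<in>space N. \<bar>g s * h s\<bar> \<le> \<bar>D\<bar> * \<bar>E\<bar>"
    using DE by (auto simp: abs_mult intro!: mult_mono intro: order_trans[OF _ abs_ge_self])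
  then show ?thesis unfolding bounded_meas_def by auto
qed

lemma bounded_meas_const: "bounded_meas (\<lambda>s. c)"
  by (auto simp: bounded_meas_def)

lemma bounded_meas_diff: 
  assumes "bounded_meas g" "bounded_meas h"
  shows "bounded_meas (\<lambda>s. g s - h s)"
  using bounded_meas_add[OF assms(1) bounded_meas_mult[OF bounded_meas_const[of "-1"] assms(2)]] by simp

lemma bounded_meas_sum:
  "(\<And>i. i \<in> I \<Longrightarrow> bounded_meas (h i)) \<Longrightarrow> bounded_meas (\<lambda>s. \<Sum>i\<in>I. h i s)"
  by (induction I rule: infinite_finite_induct)
     (auto simp: bounded_meas_const intro: bounded_meas_add)

lemma bounded_meas_mean: "bounded_meas mean"
  using mean_bound by (auto simp: bounded_meas_def)

lemma bounded_meas_W: "x \<in> space P \<Longrightarrow> bounded_meas (W x)"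
  using W_bound by (auto simp: bounded_meas_def)

lemma integrable_bounded_meas: 
  assumes "bounded_meas h" shows "integrable N h"
proof -
  obtain D where "\<forall>s\<in>space N. \<bar>h s\<bar> \<le> D" using assms unfolding bounded_meas_def by auto
  then show ?thesis
    using assms by (intro N.integrable_const_bound[of _ D]) (auto simp: bounded_meas_def)
qed

lemma integrable_mult_bounded_meas:
  assumes "bounded_meas g" "bounded_meas h" 
  shows "integrable N (\<lambda>s. g s * h s)" "integrable N (\<lambda>s. (g s)\<^sup>2)"
  using assms by (auto simp: power2_eq_square intro: integrable_bounded_meas bounded_meas_mult)

lemma cauchy_schwarz_L2:
  assumes "bounded_meas g" "bounded_meas h"
  shows "\<bar>LINT s|N. g s * h s\<bar> \<le> L2 g * L2 h"
proof -
  have "(LINT s|N. g s * h s)\<^sup>2 \<le> (L2 g * L2 h)\<^sup>2"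
    unfolding power_mult_distrib L2_sq using assms
    by (intro integral_cauchy_schwarz integrable_mult_bounded_meas)
  then show ?thesis
    by (rule abs_le_square_iff[THEN iffD2, THEN order_trans]) simp
qed

lemma L2_add_sq:
  assumes "bounded_meas g" "bounded_meas h"
  shows "(L2 (\<lambda>s. g s + h s))\<^sup>2 = (L2 g)\<^sup>2 + 2 * (LINT s|N. g s * h s) + (L2 h)\<^sup>2"
proof -
  have "(LINT s|N. (g s + h s)\<^sup>2) = (LINT s|N. (g s)\<^sup>2 + 2 * (g s * h s) + (h s)\<^sup>2)"
    by (rule Bochner_Integration.integral_cong) (simp_all add: power2_eq_square algebra_simps)
  also have "\<dots> = (LINT s|N. (g s)\<^sup>2) + 2 * (LINT s|N. g s * h s) + (LINT s|N. (h s)\<^sup>2)"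
    using assms by (simp add: integrable_mult_bounded_meas)
  finally show ?thesis by (simp add: L2_sq)
qed

lemma expectation_inner_W:
  assumes "bounded_meas g"
  shows "(LINT x|P. LINT s|N. g s * W x s) = (LINT s|N. g s * mean s)"
    and "integrable P (\<lambda>x. LINT s|N. g s * W x s)"
proof -
  interpret PN: pair_sigma_finite P N ..
  interpret PN: finite_measure "P \<Otimes>\<^sub>M N"
    by (intro finite_measure_pair_measure) unfold_locales
  note [measurable] = assms[THEN bounded_meas_measurable]
  obtain D where D: "\<forall>s\<in>space N. \<bar>g s\<bar> \<le> D" using assms unfolding bounded_meas_def by auto
  have i: "integrable (P \<Otimes>\<^sub>M N) (\<lambda>(x, s). g s * W x s)"
  proof (rule PN.integrable_const_bound[of _ "\<bar>D\<bar> * C"])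
    show "AE z in P \<Otimes>\<^sub>M N. norm (case z of (x, s) \<Rightarrow> g s * W x s) \<le> \<bar>D\<bar> * C"
      using D W_bound C_nonneg
      by (intro AE_I2) (fastforce simp: abs_mult space_pair_measure intro!: mult_mono intro: order_trans[OF _ abs_ge_self])
  qed measurable
  show "integrable P (\<lambda>x. LINT s|N. g s * W x s)"
    using PN.integrable_fst'[OF i] by simp
  have "(LINT x|P. LINT s|N. g s * W x s) = (LINT s|N. LINT x|P. g s * W x s)"
    by (rule PN.Fubini_integral[OF i, symmetric])
  also have "\<dots> = (LINT s|N. g s * mean s)"
    by (simp add: mean_def)
  finally show "(LINT x|P. LINT s|N. g s * W x s) = (LINT s|N. g s * mean s)" .
qed

text \<open>The induction step, where \<open>S\<close> is the part of the sum that is already known.  Put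
\<open>A = S - mean\<close>, so the new sum is \<open>A + W x\<close>, and let \<open>a = \<parallel>A\<parallel>\<close>.  By the chord
estimate the expectation of \<open>cosh \<parallel>A + W x\<parallel>\<close> is at most the one in which
\<open>W x\<close> is replaced by a vector \<open>\<plusminus>r\<close> in the direction of \<open>A\<close> with the same mean
component \<open>e = \<langle>A, mean\<rangle> / a\<close>.  That problem is one-dimensional, and Hoeffding's
two-point lemma bounds it by \<open>cosh (a + e) exp (r\<^sup>2 / 2)\<close>.  Finally \<open>a + e\<close> is the component
of \<open>S = A + mean\<close> along \<open>A\<close>, hence at most \<open>\<parallel>S\<parallel>\<close>.  Centring by the mean therefore costs
nothing, whereas the crude bound \<open>\<parallel>W x - mean\<parallel> \<le> 2 r\<close> would lose a factor of four in
the exponent.\<close>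

lemma cosh_L2_step:
  assumes S: "bounded_meas S"
  shows "(\<integral>\<^sup>+ x. cosh (L2 (\<lambda>s. S s + (W x s - mean s))) \<partial>P) \<le> cosh (L2 S) * exp (r\<^sup>2 / 2)"
proof -
  define A where "A s = S s - mean s" for s
  define a where "a = L2 A"
  define b where "b x = (LINT s|N. A s * W x s)" for x
  have A: "bounded_meas A"
    unfolding A_def by (intro bounded_meas_diff S bounded_meas_mean)
  have a0: "a \<ge> 0" by (simp add: a_def)
  have L2W: "L2 (W x) \<le> r" if "x \<in> space P" for x
    using W_norm[OF that] r_pos by (simp add: L2_def real_le_lsqrt)
  have bx: "\<bar>b x\<bar> \<le> a * r" if "x \<in> space P" for x
    unfolding b_def a_def
    by (rule order_trans[OF cauchy_schwarz_L2[OF A bounded_meas_W[OF that]]])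
       (simp add: L2W[OF that] mult_left_mono)
  have L: "L2 (\<lambda>s. S s + (W x s - mean s)) \<le> sqrt (a\<^sup>2 + 2 * b x + r\<^sup>2)" if "x \<in> space P" for x
  proof (rule real_le_rsqrt)
    have "(L2 (\<lambda>s. S s + (W x s - mean s)))\<^sup>2 = (L2 (\<lambda>s. A s + W x s))\<^sup>2"
      by (simp add: A_def algebra_simps)
    also have "\<dots> = a\<^sup>2 + 2 * b x + (L2 (W x))\<^sup>2"
      unfolding a_def b_def by (rule L2_add_sq[OF A bounded_meas_W[OF that]])
    finally show "(L2 (\<lambda>s. S s + (W x s - mean s)))\<^sup>2 \<le> a\<^sup>2 + 2 * b x + r\<^sup>2"
      using W_norm[OF that] by (simp add: L2_sq)
  qed
  show ?thesis
  proof (cases "a = 0")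
    case True
    have "cosh (L2 (\<lambda>s. S s + (W x s - mean s))) \<le> cosh (L2 S) * exp (r\<^sup>2 / 2)" if "x \<in> space P" for x
    proof -
      have "cosh (L2 (\<lambda>s. S s + (W x s - mean s))) \<le> cosh r"
        using L[OF that] bx[OF that] True r_pos by (intro cosh_mono_abs) simp
      also have "\<dots> \<le> exp (r\<^sup>2 / 2)" using cosh_add_sinh_le_exp[of r 0] r_pos by simp
      also have "\<dots> \<le> cosh (L2 S) * exp (r\<^sup>2 / 2)" using cosh_real_ge_1[of "L2 S"] by simp
      finally show ?thesis .
    qed
    then have "(\<integral>\<^sup>+ x. cosh (L2 (\<lambda>s. S s + (W x s - mean s))) \<partial>P)
        \<le> (\<integral>\<^sup>+ x. ennreal (cosh (L2 S) * exp (r\<^sup>2 / 2)) \<partial>P)"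
      by (intro nn_integral_mono ennreal_leI)
    then show ?thesis by (simp add: P.emeasure_space_1)
  next
    case False
    with a0 have a: "a > 0" by simp
    \<comment> \<open>The component of the mean in the direction of \<open>A\<close>.\<close>
    define e where "e = (LINT s|N. A s * mean s) / a"
    have Ee: "(LINT x|P. b x) = a * e" and bi: "integrable P b"
      unfolding b_def e_def using expectation_inner_W[OF A] a by simp_all
    have "\<bar>LINT x|P. b x\<bar> \<le> a * r"
    proof -
      have "\<bar>LINT x|P. b x\<bar> \<le> (LINT x|P. \<bar>b x\<bar>)" by (rule integral_abs_bound)
      also have "\<dots> \<le> (LINT x|P. a * r)" using bi bx by (intro integral_mono) auto
      finally show ?thesis by (simp add: P.prob_space)
    qed
    then have er: "\<bar>e\<bar> \<le> r" using a by (simp add: Ee abs_mult)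
    have "\<bar>a * e\<bar> \<le> a * L2 mean"
      unfolding e_def using cauchy_schwarz_L2[OF A bounded_meas_mean] a by (simp add: a_def)
    then have "e\<^sup>2 \<le> (L2 mean)\<^sup>2" using a by (simp add: abs_mult abs_le_square_iff[symmetric])
    moreover have "(L2 S)\<^sup>2 = a\<^sup>2 + 2 * (a * e) + (L2 mean)\<^sup>2"
      using L2_add_sq[OF A bounded_meas_mean] a by (simp add: A_def e_def a_def)
    ultimately have "(a + e)\<^sup>2 \<le> (L2 S)\<^sup>2" by (simp add: power2_eq_square algebra_simps)
    then have ae: "\<bar>a + e\<bar> \<le> L2 S" by (simp add: abs_le_square_iff[symmetric])
    have "(\<integral>\<^sup>+ x. cosh (L2 (\<lambda>s. S s + (W x s - mean s))) \<partial>P)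
      \<le> (\<integral>\<^sup>+ x. ennreal (cosh a * cosh r + b x / (a * r) * (sinh a * sinh r)) \<partial>P)"
    proof (intro nn_integral_mono ennreal_leI)
      fix x assume x: "x \<in> space P"
      have "cosh (L2 (\<lambda>s. S s + (W x s - mean s))) \<le> cosh (sqrt (a\<^sup>2 + 2 * b x + r\<^sup>2))"
        using L[OF x] by (intro cosh_mono_abs) simp
      also have "\<dots> \<le> cosh a * cosh r + b x / (a * r) * (sinh a * sinh r)"
        by (rule cosh_sqrt_chord[OF a r_pos bx[OF x]])
      finally show "cosh (L2 (\<lambda>s. S s + (W x s - mean s)))
        \<le> cosh a * cosh r + b x / (a * r) * (sinh a * sinh r)" .
    qed
    also have "\<dots> = ennreal (LINT x|P. cosh a * cosh r + b x / (a * r) * (sinh a * sinh r))"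
    proof (rule nn_integral_eq_integral)
      show "integrable P (\<lambda>x. cosh a * cosh r + b x / (a * r) * (sinh a * sinh r))"
        using bi by simp
      show "AE x in P. 0 \<le> cosh a * cosh r + b x / (a * r) * (sinh a * sinh r)"
        by (intro AE_I2 order_trans[OF _ cosh_sqrt_chord[OF a r_pos bx]]) auto
    qed
    also have "(LINT x|P. cosh a * cosh r + b x / (a * r) * (sinh a * sinh r))
      = cosh a * cosh r + e / r * (sinh a * sinh r)"
      using bi a by (simp add: Ee P.prob_space)
    also have "ennreal \<dots> \<le> ennreal (cosh (a + e) * exp (r\<^sup>2 / 2))"
      by (intro ennreal_leI cosh_sinh_le_cosh_exp r_pos er)
    also have "\<dots> \<le> ennreal (cosh (L2 S) * exp (r\<^sup>2 / 2))"
      using ae by (intro ennreal_leI mult_right_mono cosh_mono_abs) auto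
    finally show ?thesis .
  qed
qed

lemma cosh_L2_sum:
  assumes "finite I"
  shows "(\<integral>\<^sup>+ x. cosh (L2 (\<lambda>s. \<Sum>i\<in>I. W (x i) s - mean s)) \<partial>(\<Pi>\<^sub>M i\<in>I. P)) \<le> exp (card I * r\<^sup>2 / 2)"
  using assms
proof induction
  case empty
  show ?case by (simp add: L2_def PiM_empty nn_integral_count_space_finite)
next
  case (insert k I)
  interpret product_sigma_finite "\<lambda>_. P" ..
  have "(\<integral>\<^sup>+ x. cosh (L2 (\<lambda>s. \<Sum>i\<in>insert k I. W (x i) s - mean s)) \<partial>(\<Pi>\<^sub>M i\<in>insert k I. P))
    = (\<integral>\<^sup>+ x. \<integral>\<^sup>+ z. cosh (L2 (\<lambda>s. \<Sum>i\<in>insert k I. W ((x(k := z)) i) s - mean s)) \<partial>P \<partial>(\<Pi>\<^sub>M i\<in>I. P))"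
    unfolding L2_def cosh_field_def by (intro product_nn_integral_insert insert) measurable
  also have "\<dots> = (\<integral>\<^sup>+ x. \<integral>\<^sup>+ z. cosh (L2 (\<lambda>s. (\<Sum>i\<in>I. W (x i) s - mean s) + (W z s - mean s))) \<partial>P \<partial>(\<Pi>\<^sub>M i\<in>I. P))"
  proof -
    have "(\<Sum>i\<in>insert k I. W ((x(k := z)) i) s - mean s)
       = (\<Sum>i\<in>I. W (x i) s - mean s) + (W z s - mean s)" for x z s
    proof -
      have "(\<Sum>i\<in>I. W ((x(k := z)) i) s - mean s) = (\<Sum>i\<in>I. W (x i) s - mean s)"
        using insert by (intro sum.cong) auto
      then show ?thesis using insert by simp
    qed
    then show ?thesis by simp
  qed
  also have "\<dots> \<le> (\<integral>\<^sup>+ x. ennreal (cosh (L2 (\<lambda>s. \<Sum>i\<in>I. W (x i) s - mean s))) * exp (r\<^sup>2 / 2) \<partial>(\<Pi>\<^sub>M i\<in>I. P))"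
  proof (rule nn_integral_mono)
    fix x assume x: "x \<in> space (\<Pi>\<^sub>M i\<in>I. P)"
    have "bounded_meas (\<lambda>s. \<Sum>i\<in>I. W (x i) s - mean s)"
      using x by (intro bounded_meas_sum bounded_meas_diff bounded_meas_W bounded_meas_mean)
         (auto simp: space_PiM PiE_iff)
    from cosh_L2_step[OF this]
    show "(\<integral>\<^sup>+ z. cosh (L2 (\<lambda>s. (\<Sum>i\<in>I. W (x i) s - mean s) + (W z s - mean s))) \<partial>P)
      \<le> ennreal (cosh (L2 (\<lambda>s. \<Sum>i\<in>I. W (x i) s - mean s))) * exp (r\<^sup>2 / 2)"
      by (simp add: ennreal_mult)
  qed
  also have "\<dots> = (\<integral>\<^sup>+ x. ennreal (cosh (L2 (\<lambda>s. \<Sum>i\<in>I. W (x i) s - mean s))) \<partial>(\<Pi>\<^sub>M i\<in>I. P)) * exp (r\<^sup>2 / 2)"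
    unfolding L2_def cosh_field_def by (intro nn_integral_multc) measurable
  also have "\<dots> \<le> ennreal (exp (card I * r\<^sup>2 / 2)) * exp (r\<^sup>2 / 2)"
    by (intro mult_right_mono insert.IH) simp
  also have "\<dots> = exp (card (insert k I) * r\<^sup>2 / 2)"
    using insert by (simp add: ennreal_mult[symmetric] exp_add[symmetric] field_simps)
  finally show ?case .
qed

text \<open>The scale \<open>l\<close> is the free parameter of the exponential Markov inequality.  It comes for free,
since \<open>l W\<close> is again a bounded random function, with values in the ball of radius \<open>l r\<close>.\<close>

lemma cosh_L2_sum_scaled:
  assumes "finite I" "l > 0"
  shows "(\<integral>\<^sup>+ x. cosh (l * L2 (\<lambda>s. \<Sum>i\<in>I. W (x i) s - mean s)) \<partial>(\<Pi>\<^sub>M i\<in>I. P))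
    \<le> exp (card I * (l * r)\<^sup>2 / 2)"
proof -
  interpret scaled: bounded_random_function P N "\<lambda>x s. l * W x s" "l * C" "l * r"
  proof
    show "(\<lambda>(x, s). l * W x s) \<in> borel_measurable (P \<Otimes>\<^sub>M N)" by measurable
  qed (use assms W_bound W_norm r_pos in \<open>auto simp: abs_mult power_mult_distrib\<close>)
  have "scaled.mean = (\<lambda>s. l * mean s)"
    by (simp add: scaled.mean_def mean_def fun_eq_iff)
  then have "(\<Sum>i\<in>I. l * W (x i) s - scaled.mean s) = l * (\<Sum>i\<in>I. W (x i) s - mean s)" for x s
    by (simp add: sum_distrib_left right_diff_distrib)
  moreover have "L2 (\<lambda>s. l * h s) = l * L2 h" for h
    using assms by (simp add: L2_def power_mult_distrib real_sqrt_mult)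
  ultimately show ?thesis
    using scaled.cosh_L2_sum[OF assms(1)] by simp
qed

text \<open>Hoeffding's inequality in Hilbert space, by the exponential Markov inequality.  The factor
2 is the price of \<open>exp z \<le> 2 cosh z\<close>.\<close>

theorem L2_hoeffding:
  assumes I: "finite I" "I \<noteq> {}" and t: "t > 0"
  shows "measure (\<Pi>\<^sub>M i\<in>I. P) {x \<in> space (\<Pi>\<^sub>M i\<in>I. P). t \<le> L2 (\<lambda>s. \<Sum>i\<in>I. W (x i) s - mean s)}
    \<le> 2 * exp (- (t\<^sup>2 / (2 * card I * r\<^sup>2)))"
proof -
  define Q where "Q = (\<Pi>\<^sub>M i\<in>I. P)"
  \<comment> \<open>The minimiser of \<open>card I * (l * r)\<^sup>2 / 2 - l * t\<close>.\<close>
  define l where "l = t / (card I * r\<^sup>2)"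
  define Z where "Z x = L2 (\<lambda>s. \<Sum>i\<in>I. W (x i) s - mean s)" for x
  have [measurable]: "Z \<in> borel_measurable Q"
    unfolding Z_def L2_def Q_def by measurable
  interpret Q: prob_space Q
    unfolding Q_def by (intro prob_space_PiM) unfold_locales
  have c: "real (card I) > 0" using I by (simp add: card_gt_0_iff)
  have l: "l > 0" unfolding l_def using t r_pos c by simp
  have "ennreal (exp (l * t) / 2) * emeasure Q {x \<in> space Q. t \<le> Z x}
      = (\<integral>\<^sup>+ x. ennreal (exp (l * t) / 2) * indicator {x \<in> space Q. t \<le> Z x} x \<partial>Q)"
    by (intro nn_integral_cmult_indicator[symmetric]) measurable
  also have "\<dots> \<le> (\<integral>\<^sup>+ x. cosh (l * Z x) \<partial>Q)"
  proof (rule nn_integral_mono)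
    fix x
    have "exp (l * t) / 2 \<le> cosh (l * Z x)" if "t \<le> Z x"
    proof -
      have "exp (l * t) \<le> exp (l * Z x)" using that l by simp
      then show ?thesis by (simp add: cosh_field_def add_increasing2)
    qed
    then show "ennreal (exp (l * t) / 2) * indicator {x \<in> space Q. t \<le> Z x} x \<le> cosh (l * Z x)"
      by (auto simp: indicator_def intro!: ennreal_leI)
  qed
  also have "\<dots> \<le> exp (card I * (l * r)\<^sup>2 / 2)"
    unfolding Z_def Q_def by (rule cosh_L2_sum_scaled[OF I(1) l])
  finally have "exp (l * t) / 2 * Q.prob {x \<in> space Q. t \<le> Z x} \<le> exp (card I * (l * r)\<^sup>2 / 2)"
    by (simp add: Q.emeasure_eq_measure flip: ennreal_mult)
  then have "Q.prob {x \<in> space Q. t \<le> Z x} \<le> 2 * (exp (card I * (l * r)\<^sup>2 / 2) * exp (- (l * t)))"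
    by (simp add: exp_minus field_simps)
  also have "exp (card I * (l * r)\<^sup>2 / 2) * exp (- (l * t)) = exp (card I * (l * r)\<^sup>2 / 2 - l * t)"
    by (simp flip: exp_add)
  also have "card I * (l * r)\<^sup>2 / 2 - l * t = - (t\<^sup>2 / (2 * card I * r\<^sup>2))"
    unfolding l_def using c r_pos by (simp add: field_simps power2_eq_square)
  finally show ?thesis by (simp add: Q_def Z_def)
qed

end

section \<open>Polar coordinates\<close>

lemma nn_integral_lborel_scaleR:
  fixes g :: "'a::euclidean_space \<Rightarrow> ennreal"
  assumes [measurable]: "g \<in> borel_measurable borel" and "c > 0"
  shows "(\<integral>\<^sup>+ x. g x \<partial>lborel) = ennreal (c ^ DIM('a)) * (\<integral>\<^sup>+ x. g (c *\<^sub>R x) \<partial>lborel)"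
  using assms(2)
  by (subst lborel_affine[of c 0])
     (simp_all add: nn_integral_density nn_integral_distr nn_integral_cmult)

lemma nn_integral_sphere_measure:
  fixes g :: "real ^ 'n \<Rightarrow> ennreal"
  assumes [measurable]: "g \<in> borel_measurable borel"
  shows "(\<integral>\<^sup>+ \<theta>. g \<theta> \<partial>sphere_measure)
    = of_nat CARD('n) * (\<integral>\<^sup>+ x. g (sgn x) * indicator (cball 0 1 - {0}) x \<partial>lborel)"
proof -
  have g: "g \<in> borel_measurable (restrict_space borel (sphere 0 1))"
    by (rule measurable_restrict_space1) fact
  have "(\<integral>\<^sup>+ \<theta>. g \<theta> \<partial>sphere_measure)
     = of_nat CARD('n) * (\<integral>\<^sup>+ x. g (sgn x) \<partial>restrict_space lborel (cball 0 1 - {0}))"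
    unfolding sphere_measure_def using g
    by (subst nn_integral_scale_measure) (simp_all add: nn_integral_distr[OF sgn_measurable_sphere])
  then show ?thesis
    by (subst (asm) nn_integral_restrict_space) auto
qed

lemma nn_integral_power_tail:
  assumes "R > 0" "n > 0"
  shows "(\<integral>\<^sup>+ t. ennreal (real n / t ^ Suc n) * indicator {R..} t \<partial>lborel) = ennreal (1 / R ^ n)"
proof -
  have "(\<integral>\<^sup>+ t. ennreal (indicator {R..} t * (real n / t ^ Suc n)) * indicator {R..} t \<partial>lborel) = ennreal (0 - (- (1 / R ^ n)))"
  proof (rule nn_integral_FTC_atLeast)
    fix t assume "R \<le> t"
    then have t: "t > 0" using assms by simp
    have "((\<lambda>t. - (1 / t ^ n)) has_real_derivative - ((0 * t ^ n - 1 * (real n * t ^ (n - 1))) / (t ^ n * t ^ n))) (at t)"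
      using t by (auto intro!: derivative_eq_intros)
    also have "- ((0 * t ^ n - 1 * (real n * t ^ (n - 1))) / (t ^ n * t ^ n)) = indicator {R..} t * (real n / t ^ Suc n)"
      using t \<open>R \<le> t\<close> assms(2) by (cases n) (simp_all add: field_simps)
    finally show "((\<lambda>t. - (1 / t ^ n)) has_real_derivative indicator {R..} t * (real n / t ^ Suc n)) (at t)" .
    show "0 \<le> indicator {R..} t * (real n / t ^ Suc n)" using t by simp
  next
    show "((\<lambda>t. - (1 / t ^ n)) \<longlongrightarrow> (0::real)) at_top"
      using assms(2) by real_asymp
  qed measurable
  moreover have "ennreal (indicator {R..} t * (real n / t ^ Suc n)) * indicator {R..} t
      = ennreal (real n / t ^ Suc n) * indicator {R..} t" for t
    by (simp add: indicator_def)
  ultimately show ?thesis by simp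
qed

lemma sgn_borel_measurable [measurable]: "(sgn :: 'a::euclidean_space \<Rightarrow> 'a) \<in> borel_measurable borel"
  unfolding sgn_div_norm by measurable

text \<open>Polar coordinates for the cone measure need only linear substitutions and Tonelli's theorem.
Write the spherical integral as \<open>n\<close> times an integral over the unit ball, with integrand
\<open>g (r *\<^sub>R sgn x)\<close>.  For fixed \<open>x\<close> substitute \<open>r = t \<bar>x\<bar>\<close>, which turns the
argument of \<open>g\<close> into \<open>t x\<close>; then, for fixed \<open>t\<close>, substitute \<open>x = z / t\<close>.  The condition
\<open>\<bar>x\<bar> \<le> 1\<close> becomes \<open>\<bar>z\<bar> \<le> t\<close>, and the remaining integral over \<open>t\<close> is
\<open>\<bar>z\<bar> ^ n\<close> times that of \<open>n / t ^ (n + 1)\<close> over \<open>[\<bar>z\<bar>, \<infinity>)\<close>, which is 1.\<close>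

lemma nn_integral_polar:
  fixes g :: "real ^ 'n \<Rightarrow> ennreal"
  assumes [measurable]: "g \<in> borel_measurable borel"
  shows "(\<integral>\<^sup>+ r. ennreal (r ^ (CARD('n) - 1)) * (\<integral>\<^sup>+ \<theta>. g (r *\<^sub>R \<theta>) \<partial>sphere_measure) * indicator {0<..} r \<partial>lborel)
    = (\<integral>\<^sup>+ x. g x \<partial>lborel)"
proof -
  define n where "n = CARD('n)"
  have n: "n > 0" by (simp add: n_def)
  define H :: "real \<Rightarrow> real ^ 'n \<Rightarrow> ennreal" where "H t z = (if norm z \<le> t \<and> z \<noteq> 0 then 1 else 0)" for t z
  have [measurable]: "case_prod H \<in> borel_measurable (borel \<Otimes>\<^sub>M borel)"
    unfolding H_def by measurable
  define B :: "real ^ 'n \<Rightarrow> ennreal" where "B = indicator (cball 0 1 - {0})"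
  have [measurable]: "B \<in> borel_measurable borel"
    unfolding B_def by (intro borel_measurable_indicator) auto
  have [simp]: "B 0 = 0" by (simp add: B_def)
  let ?P = "indicator {0<..} :: real \<Rightarrow> ennreal"
  have "(\<integral>\<^sup>+ r. ennreal (r ^ (n - 1)) * (\<integral>\<^sup>+ \<theta>. g (r *\<^sub>R \<theta>) \<partial>sphere_measure) * ?P r \<partial>lborel)
     = (\<integral>\<^sup>+ r. \<integral>\<^sup>+ x. of_nat n * ennreal (r ^ (n - 1)) * g (r *\<^sub>R sgn x) * B x * ?P r \<partial>lborel \<partial>lborel)"
  proof (rule nn_integral_cong)
    fix r :: real
    have "(\<integral>\<^sup>+ \<theta>. g (r *\<^sub>R \<theta>) \<partial>sphere_measure) = of_nat n * (\<integral>\<^sup>+ x. g (r *\<^sub>R sgn x) * B x \<partial>lborel)"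
      unfolding n_def B_def by (rule nn_integral_sphere_measure) measurable
    then have "ennreal (r ^ (n - 1)) * (\<integral>\<^sup>+ \<theta>. g (r *\<^sub>R \<theta>) \<partial>sphere_measure) * ?P r
      = (of_nat n * ennreal (r ^ (n - 1)) * ?P r) * (\<integral>\<^sup>+ x. g (r *\<^sub>R sgn x) * B x \<partial>lborel)"
      by (simp add: mult_ac)
    also have "\<dots> = (\<integral>\<^sup>+ x. (of_nat n * ennreal (r ^ (n - 1)) * ?P r) * (g (r *\<^sub>R sgn x) * B x) \<partial>lborel)"
      by (rule nn_integral_cmult[symmetric]) measurable
    finally show "ennreal (r ^ (n - 1)) * (\<integral>\<^sup>+ \<theta>. g (r *\<^sub>R \<theta>) \<partial>sphere_measure) * ?P r
      = (\<integral>\<^sup>+ x. of_nat n * ennreal (r ^ (n - 1)) * g (r *\<^sub>R sgn x) * B x * ?P r \<partial>lborel)"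
      by (simp add: mult_ac)
  qed
  also have "\<dots> = (\<integral>\<^sup>+ x. \<integral>\<^sup>+ r. of_nat n * ennreal (r ^ (n - 1)) * g (r *\<^sub>R sgn x) * B x * ?P r \<partial>lborel \<partial>lborel)"
    by (rule lborel_pair.Fubini') measurable
  \<comment> \<open>Substitute \<open>r = t |x|\<close>.\<close>
  also have "\<dots> = (\<integral>\<^sup>+ x. \<integral>\<^sup>+ t. of_nat n * ennreal (t ^ (n - 1) * norm x ^ n) * g (t *\<^sub>R x) * B x * ?P t \<partial>lborel \<partial>lborel)"
  proof (rule nn_integral_cong)
    fix x :: "real ^ 'n"
    show "(\<integral>\<^sup>+ r. of_nat n * ennreal (r ^ (n - 1)) * g (r *\<^sub>R sgn x) * B x * ?P r \<partial>lborel)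
      = (\<integral>\<^sup>+ t. of_nat n * ennreal (t ^ (n - 1) * norm x ^ n) * g (t *\<^sub>R x) * B x * ?P t \<partial>lborel)"
    proof (cases "x = 0")
      case False
      have "(\<integral>\<^sup>+ r. of_nat n * ennreal (r ^ (n - 1)) * g (r *\<^sub>R sgn x) * B x * ?P r \<partial>lborel)
        = ennreal (norm x) * (\<integral>\<^sup>+ t. of_nat n * ennreal ((norm x * t) ^ (n - 1)) * g ((norm x * t) *\<^sub>R sgn x) * B x * ?P (norm x * t) \<partial>lborel)"
        using False by (subst nn_integral_real_affine[of _ "norm x" 0]) auto
      also have "\<dots> = (\<integral>\<^sup>+ t. ennreal (norm x) * (of_nat n * ennreal ((norm x * t) ^ (n - 1)) * g ((norm x * t) *\<^sub>R sgn x) * B x * ?P (norm x * t)) \<partial>lborel)"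
        by (rule nn_integral_cmult[symmetric]) measurable
      also have "\<dots> = (\<integral>\<^sup>+ t. of_nat n * ennreal (t ^ (n - 1) * norm x ^ n) * g (t *\<^sub>R x) * B x * ?P t \<partial>lborel)"
      proof (rule nn_integral_cong)
        fix t :: real
        show "ennreal (norm x) * (of_nat n * ennreal ((norm x * t) ^ (n - 1)) * g ((norm x * t) *\<^sub>R sgn x) * B x * ?P (norm x * t))
          = of_nat n * ennreal (t ^ (n - 1) * norm x ^ n) * g (t *\<^sub>R x) * B x * ?P t"
        proof (cases "t > 0")
          case True
          have "ennreal (norm x) * ennreal ((norm x * t) ^ (n - 1)) = ennreal (t ^ (n - 1) * norm x ^ n)"
            using True n by (cases n) (simp_all add: power_mult_distrib mult_ac flip: ennreal_mult)
          moreover have "(norm x * t) *\<^sub>R sgn x = t *\<^sub>R x"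
            using False by (simp add: sgn_div_norm)
          moreover have "?P (norm x * t) = ?P t" using True False by (simp add: indicator_def)
          moreover have "ennreal (norm x) * (of_nat n * ennreal ((norm x * t) ^ (n - 1)) * g ((norm x * t) *\<^sub>R sgn x) * B x * ?P (norm x * t))
            = of_nat n * (ennreal (norm x) * ennreal ((norm x * t) ^ (n - 1))) * g ((norm x * t) *\<^sub>R sgn x) * B x * ?P (norm x * t)"
            by (simp only: mult_ac)
          ultimately show ?thesis by (simp only:)
        next
          case f: False
          then show ?thesis using False by (simp add: indicator_def zero_less_mult_iff)
        qed
      qed
      finally show ?thesis .
    qed simp
  qed
  also have "\<dots> = (\<integral>\<^sup>+ t. \<integral>\<^sup>+ x. of_nat n * ennreal (t ^ (n - 1) * norm x ^ n) * g (t *\<^sub>R x) * B x * ?P t \<partial>lborel \<partial>lborel)"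
    by (rule lborel_pair.Fubini') measurable
  \<comment> \<open>Substitute \<open>x = z / t\<close>.\<close>
  also have "\<dots> = (\<integral>\<^sup>+ t. \<integral>\<^sup>+ z. ennreal (real n / t ^ Suc n) * (ennreal (norm z ^ n) * g z) * H t z \<partial>lborel \<partial>lborel)"
  proof (rule nn_integral_cong)
    fix t :: real
    show "(\<integral>\<^sup>+ x. of_nat n * ennreal (t ^ (n - 1) * norm x ^ n) * g (t *\<^sub>R x) * B x * ?P t \<partial>lborel)
      = (\<integral>\<^sup>+ z. ennreal (real n / t ^ Suc n) * (ennreal (norm z ^ n) * g z) * H t z \<partial>lborel)"
    proof (cases "t > 0")
      case True
      have "(\<integral>\<^sup>+ z. ennreal (real n / t ^ Suc n) * (ennreal (norm z ^ n) * g z) * H t z \<partial>lborel)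
        = ennreal (t ^ n) * (\<integral>\<^sup>+ x. ennreal (real n / t ^ Suc n) * (ennreal (norm (t *\<^sub>R x) ^ n) * g (t *\<^sub>R x)) * H t (t *\<^sub>R x) \<partial>lborel)"
        using True by (subst nn_integral_lborel_scaleR[of _ t]) (simp_all add: n_def, measurable)
      also have "\<dots> = (\<integral>\<^sup>+ x. ennreal (t ^ n) * (ennreal (real n / t ^ Suc n) * (ennreal (norm (t *\<^sub>R x) ^ n) * g (t *\<^sub>R x)) * H t (t *\<^sub>R x)) \<partial>lborel)"
        by (rule nn_integral_cmult[symmetric]) measurable
      also have "\<dots> = (\<integral>\<^sup>+ x. of_nat n * ennreal (t ^ (n - 1) * norm x ^ n) * g (t *\<^sub>R x) * B x * ?P t \<partial>lborel)"
      proof (rule nn_integral_cong)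
        fix x :: "real ^ 'n"
        have "ennreal (t ^ n) * (ennreal (real n / t ^ Suc n) * ennreal (norm (t *\<^sub>R x) ^ n)) = ennreal (real n) * ennreal (t ^ (n - 1) * norm x ^ n)"
        proof -
          have "t ^ n * (real n / t ^ Suc n * norm (t *\<^sub>R x) ^ n) = real n * (t ^ (n - 1) * norm x ^ n)"
            using True n by (cases n) (simp_all add: power_mult_distrib field_simps)
          then show ?thesis using True by (simp flip: ennreal_mult)
        qed
        moreover have "H t (t *\<^sub>R x) = B x * ?P t"
          using True by (auto simp: B_def H_def indicator_def)
        moreover have "ennreal (t ^ n) * (ennreal (real n / t ^ Suc n) * (ennreal (norm (t *\<^sub>R x) ^ n) * g (t *\<^sub>R x)) * H t (t *\<^sub>R x))
          = ennreal (t ^ n) * (ennreal (real n / t ^ Suc n) * ennreal (norm (t *\<^sub>R x) ^ n)) * g (t *\<^sub>R x) * H t (t *\<^sub>R x)"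
          by (simp only: mult_ac)
        ultimately show "ennreal (t ^ n) * (ennreal (real n / t ^ Suc n) * (ennreal (norm (t *\<^sub>R x) ^ n) * g (t *\<^sub>R x)) * H t (t *\<^sub>R x))
          = of_nat n * ennreal (t ^ (n - 1) * norm x ^ n) * g (t *\<^sub>R x) * B x * ?P t"
          by (simp only: ennreal_of_nat_eq_real_of_nat mult.assoc)
      qed
      finally show ?thesis ..
    next
      case False
      then have "H t z = 0" for z
        by (auto simp: H_def not_less dest: order_trans)
      with False show ?thesis by simp
    qed
  qed
  also have "\<dots> = (\<integral>\<^sup>+ z. \<integral>\<^sup>+ t. ennreal (real n / t ^ Suc n) * (ennreal (norm z ^ n) * g z) * H t z \<partial>lborel \<partial>lborel)"
    by (rule lborel_pair.Fubini') measurable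
  also have "\<dots> = (\<integral>\<^sup>+ z. g z * indicator (- {0}) z \<partial>lborel)"
  proof (rule nn_integral_cong)
    fix z :: "real ^ 'n"
    show "(\<integral>\<^sup>+ t. ennreal (real n / t ^ Suc n) * (ennreal (norm z ^ n) * g z) * H t z \<partial>lborel)
      = g z * indicator (- {0}) z"
    proof (cases "z = 0")
      case False
      then have "(\<integral>\<^sup>+ t. ennreal (real n / t ^ Suc n) * (ennreal (norm z ^ n) * g z) * H t z \<partial>lborel)
         = (\<integral>\<^sup>+ t. (ennreal (real n / t ^ Suc n) * indicator {norm z..} t) * (ennreal (norm z ^ n) * g z) \<partial>lborel)"
        by (intro nn_integral_cong) (simp add: H_def indicator_def)
      also have "\<dots> = ennreal (1 / norm z ^ n) * (ennreal (norm z ^ n) * g z)"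
        using False n by (subst nn_integral_multc) (measurable, simp add: nn_integral_power_tail del: power_Suc)
      also have "\<dots> = g z"
        using False by (simp flip: mult.assoc ennreal_mult)
      finally show ?thesis using False by simp
    qed (simp add: H_def)
  qed
  also have "\<dots> = (\<integral>\<^sup>+ z. g z \<partial>lborel)"
    by (rule nn_integral_cong_AE) (use AE_lborel_singleton[of 0] in eventually_elim, auto)
  finally show ?thesis unfolding n_def .
qed

lemma space_sphere_measure [simp]: "space (sphere_measure :: (real ^ 'n) measure) = sphere 0 1"
  by (simp add: sphere_measure_def space_scale_measure space_restrict_space)

lemma measurable_sphere_measure:
  "g \<in> borel_measurable borel \<Longrightarrow> g \<in> borel_measurable (sphere_measure :: (real ^ 'n) measure)"
  unfolding sphere_measure_def
  by (auto intro!: measurable_restrict_space1 cong: measurable_cong_sets)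

text \<open>Polar coordinates centred at \<open>y\<close>.  The bound on \<open>f\<close> keeps the spherical integrals finite, so
that the two nested Lebesgue integrals agree with the corresponding nonnegative integrals
instead of taking the default value 0.\<close>

lemma spherical_Radon_eq_nn_integral:
  fixes f :: "real ^ 'n \<Rightarrow> real"
  assumes f [measurable]: "f \<in> borel_measurable borel" and f0: "\<And>x. f x \<ge> 0"
    and B: "\<And>x. f x \<le> B" and fin: "(\<integral>\<^sup>+ x. f x \<partial>lborel) < \<infinity>"
  shows "ennreal (spherical_Radon f s y) = (\<integral>\<^sup>+ x. ennreal (f x) * indicator (cball y s) x \<partial>lborel)"
proof -
  define J where "J r = (\<integral>\<^sup>+ \<theta>. ennreal (f (y + r *\<^sub>R \<theta>)) \<partial>sphere_measure)" for r
  have J_eq: "J r = of_nat CARD('n) * (\<integral>\<^sup>+ x. ennreal (f (y + r *\<^sub>R sgn x)) * indicator (cball 0 1 - {0}) x \<partial>lborel)" for r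
    unfolding J_def by (rule nn_integral_sphere_measure) measurable
  have [measurable]: "J \<in> borel_measurable borel"
  proof -
    define Bx :: "real ^ 'n \<Rightarrow> ennreal" where "Bx = indicator (cball 0 1 - {0})"
    have [measurable]: "Bx \<in> borel_measurable borel"
      unfolding Bx_def by (intro borel_measurable_indicator) auto
    show ?thesis
      unfolding J_eq[abs_def] Bx_def[symmetric] by measurable
  qed
  have J_fin: "J r < \<infinity>" for r
  proof -
    have "J r \<le> of_nat CARD('n) * (\<integral>\<^sup>+ x. ennreal B * indicator (cball 0 1) (x :: real ^ 'n) \<partial>lborel)"
      unfolding J_eq by (intro mult_left_mono nn_integral_mono) (auto simp: indicator_def intro!: ennreal_leI B)
    also have "\<dots> = of_nat CARD('n) * (ennreal B * emeasure lborel (cball (0 :: real ^ 'n) 1))"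
      by (subst nn_integral_cmult_indicator) auto
    also have "\<dots> < \<infinity>"
      using emeasure_lborel_cball_finite[of "0 :: real ^ 'n" 1]
      by (simp add: ennreal_mult_less_top of_nat_less_top)
    finally show ?thesis .
  qed
  have inner: "(LINT \<theta>|sphere_measure. f (y + r *\<^sub>R \<theta>)) = enn2real (J r)" for r
    unfolding J_def
    by (intro integral_eq_nn_integral measurable_sphere_measure) (auto simp: f0)
  have "spherical_Radon f s y = (LINT r|lborel. indicator {0..s} r * (r ^ (CARD('n) - 1) * enn2real (J r)))"
    by (simp add: spherical_Radon_def set_lebesgue_integral_def inner)
  also have "\<dots> = enn2real (\<integral>\<^sup>+ r. ennreal (indicator {0..s} r * (r ^ (CARD('n) - 1) * enn2real (J r))) \<partial>lborel)"
    by (rule integral_eq_nn_integral) (auto simp: indicator_def)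
  also have "(\<integral>\<^sup>+ r. ennreal (indicator {0..s} r * (r ^ (CARD('n) - 1) * enn2real (J r))) \<partial>lborel)
    = (\<integral>\<^sup>+ r. ennreal (r ^ (CARD('n) - 1)) * (\<integral>\<^sup>+ \<theta>. ennreal (f (y + r *\<^sub>R \<theta>)) * indicator (cball 0 s) (r *\<^sub>R \<theta>) \<partial>sphere_measure) * indicator {0<..} r \<partial>lborel)"
  proof (rule nn_integral_cong_AE)
    show "AE r in lborel. ennreal (indicator {0..s} r * (r ^ (CARD('n) - 1) * enn2real (J r)))
      = ennreal (r ^ (CARD('n) - 1)) * (\<integral>\<^sup>+ \<theta>. ennreal (f (y + r *\<^sub>R \<theta>)) * indicator (cball 0 s) (r *\<^sub>R \<theta>) \<partial>sphere_measure) * indicator {0<..} r"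
      using AE_lborel_singleton[of "0::real"]
    proof eventually_elim
      case (elim r)
      show ?case
      proof (cases "r > 0")
        case True
        have "(\<integral>\<^sup>+ \<theta>. ennreal (f (y + r *\<^sub>R \<theta>)) * indicator (cball 0 s) (r *\<^sub>R \<theta>) \<partial>sphere_measure)
          = (\<integral>\<^sup>+ \<theta>. (if r \<le> s then 1 else 0) * ennreal (f (y + r *\<^sub>R \<theta>)) \<partial>sphere_measure)"
          using True by (intro nn_integral_cong) (simp add: indicator_def)
        also have "\<dots> = (if r \<le> s then 1 else 0) * J r"
          by (simp add: J_def)
        finally show ?thesis
          using True J_fin[of r] by (simp add: indicator_def ennreal_mult')
      qed (use elim in \<open>simp add: indicator_def\<close>)
    qed
  qed
  also have "\<dots> = (\<integral>\<^sup>+ x. ennreal (f (y + x)) * indicator (cball 0 s) x \<partial>lborel)"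
    by (rule nn_integral_polar[of "\<lambda>x. ennreal (f (y + x)) * indicator (cball 0 s) x"])
       (intro borel_measurable_times_ennreal borel_measurable_indicator, auto)
  also have "\<dots> = (\<integral>\<^sup>+ x. ennreal (f x) * indicator (cball y s) x \<partial>distr lborel borel ((+) y))"
    by (subst nn_integral_distr) (auto intro!: nn_integral_cong simp: indicator_def dist_norm)
  also have "\<dots> = (\<integral>\<^sup>+ x. ennreal (f x) * indicator (cball y s) x \<partial>lborel)"
    by (simp add: lborel_distr_plus)
  finally have "spherical_Radon f s y = enn2real (\<integral>\<^sup>+ x. ennreal (f x) * indicator (cball y s) x \<partial>lborel)" .
  moreover have "(\<integral>\<^sup>+ x. ennreal (f x) * indicator (cball y s) x \<partial>lborel) < \<infinity>"
    by (rule le_less_trans[OF nn_integral_mono fin]) (auto simp: indicator_def)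
  ultimately show ?thesis by simp
qed

section \<open>Deviation of the empirical transform\<close>

lemma L2_deviation_measurable:
  fixes y :: "real ^ 'n" and X :: "nat \<Rightarrow> 'w \<Rightarrow> real ^ 'n"
  assumes F [measurable]: "F \<in> borel_measurable borel"
    and X: "\<And>i. i \<in> {1..m} \<Longrightarrow> X i \<in> borel_measurable M"
  shows "(\<lambda>\<omega>. L2_pos_norm_sq (\<lambda>s. F s - empirical_Radon m (\<lambda>i. X i \<omega>) s y)) \<in> borel_measurable M"
proof -
  have "empirical_Radon m (\<lambda>i. X i \<omega>) s y
    = 1 / real m * (\<Sum>i\<in>{1..m}. if (norm (X i \<omega> - y))\<^sup>2 \<le> s\<^sup>2 then 1 else 0)" for \<omega> s
    by (simp add: empirical_Radon_def sum.If_cases Int_def)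
  moreover have "(\<lambda>(\<omega>, s). \<Sum>i\<in>{1..m}. if (norm (X i \<omega> - y))\<^sup>2 \<le> s\<^sup>2 then 1 else (0 :: real))
    \<in> borel_measurable (M \<Otimes>\<^sub>M lborel)"
    unfolding split_beta
  proof (rule borel_measurable_sum)
    fix i assume "i \<in> {1..m}"
    note [measurable] = X[OF this]
    show "(\<lambda>x. if (norm (X i (fst x) - y))\<^sup>2 \<le> (snd x)\<^sup>2 then 1 else (0 :: real)) \<in> borel_measurable (M \<Otimes>\<^sub>M lborel)"
      by measurable
  qed
  note [measurable] = this
  ultimately show ?thesis
    unfolding L2_pos_norm_sq_def by simp
qed

text \<open>The deviation from one centre.  With \<open>a = max 0 (\<bar>y\<bar> - 1)\<close>, all points of the unit ball have
a distance to \<open>y\<close> between \<open>a\<close> and \<open>a + 2\<close>, so that the deviation vanishes outside this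
interval.  On it, apply Hoeffding's inequality in \<open>L\<^sup>2\<close> to the functions
\<open>W x s = \<plusminus>1/2\<close>, the indicator of \<open>\<bar>x - y\<bar> \<le> s\<close> minus \<open>1/2\<close>.  Subtracting \<open>1/2\<close> does not
change the centred sum but puts every \<open>W x\<close> on the sphere of squared radius
\<open>2 / 4 = 1 / 2\<close>, and \<open>exp (- (t m) / (2 m r\<^sup>2))\<close> with \<open>r\<^sup>2 = 1/2\<close> is exactly \<open>exp (- t)\<close>.\<close>

lemma L2_deviation_tail:
  fixes y :: "real ^ 'n" and X :: "nat \<Rightarrow> 'w \<Rightarrow> real ^ 'n"
  assumes M: "prob_space M" and P: "prob_space P" and P_borel: "sets P = sets borel"
    and P_ball: "measure P (ball 0 1) = 1"
    and m: "m \<ge> 1"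
    and X [measurable]: "\<And>i. i \<in> {1..m} \<Longrightarrow> X i \<in> borel_measurable M"
    and X_ball: "\<And>i \<omega>. i \<in> {1..m} \<Longrightarrow> \<omega> \<in> space M \<Longrightarrow> X i \<omega> \<in> ball 0 1"
    and X_iid: "distr M (\<Pi>\<^sub>M i\<in>{1..m}. borel) (\<lambda>\<omega>. \<lambda>i\<in>{1..m}. X i \<omega>) = (\<Pi>\<^sub>M i\<in>{1..m}. P)"
    and t: "t > 0"
  shows "measure M {\<omega> \<in> space M. ennreal (t / m) <
      L2_pos_norm_sq (\<lambda>s. measure P (cball y s) - empirical_Radon m (\<lambda>i. X i \<omega>) s y)} \<le> 2 * exp (- t)"
proof -
  interpret M: prob_space M by fact
  interpret P: prob_space P by fact
  note [measurable_cong] = P_borel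
  have space_P: "space P = UNIV" using sets_eq_imp_space_eq[OF P_borel] by simp
  define a where "a = max 0 (norm y - 1)"
  define N where "N = restrict_space lborel {a..a + 2}"
  define W where "W x s = (if norm (x - y) \<le> s then 1 / 2 else - 1 / 2 :: real)" for x s
  have N_space: "space N = {a..a + 2}" by (simp add: N_def space_restrict_space)
  have [measurable_cong]: "sets N = sets (restrict_space borel {a..a + 2})"
    unfolding N_def by (intro sets_restrict_space_cong) simp
  interpret N: finite_measure N
    by (intro finite_measureI) (simp add: N_space, simp add: N_def emeasure_restrict_space)
  have N_meas: "measure N (space N) = 2"
    by (simp add: N_space) (simp add: N_def measure_restrict_space)
  interpret bounded_random_function P N W "1 / 2" "1 / sqrt 2"
  proof
    have "(\<lambda>s. s) \<in> borel_measurable N"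
      unfolding N_def by (intro measurable_restrict_space1) simp
    from measurable_compose[OF measurable_snd this]
    have [measurable]: "snd \<in> borel_measurable (P \<Otimes>\<^sub>M N)" .
    show "case_prod W \<in> borel_measurable (P \<Otimes>\<^sub>M N)"
      unfolding W_def split_beta by measurable
    show "(LINT s|N. (W x s)\<^sup>2) \<le> (1 / sqrt 2)\<^sup>2" for x
    proof -
      have "(W x s)\<^sup>2 = 1 / 4" for s by (simp add: W_def power2_eq_square)
      then have "(LINT s|N. (W x s)\<^sup>2) = (LINT s|N. 1 / 4)" by (simp only:)
      then show ?thesis by (simp add: N_meas power_divide)
    qed
  qed (auto simp: W_def)
  have mean_eq: "mean s = measure P (cball y s) - 1 / 2" for s
  proof -
    have "mean s = (LINT x|P. indicator (cball y s) x - 1 / 2)"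
      unfolding mean_def by (rule Bochner_Integration.integral_cong)
        (auto simp: W_def indicator_def dist_norm norm_minus_commute)
    also have "\<dots> = measure P (cball y s) - 1 / 2"
    proof (subst Bochner_Integration.integral_diff)
      show "integrable P (indicator (cball y s) :: _ \<Rightarrow> real)"
        by (rule integrable_real_indicator) (auto simp: P_borel P.emeasure_eq_measure)
    qed (use P.prob_space in \<open>simp_all add: space_P\<close>)
    finally show ?thesis .
  qed
  define Z where "Z x = (\<lambda>s. \<Sum>i\<in>{1..m}. W (x i) s - mean s)" for x
  define h where "h \<omega> s = measure P (cball y s) - empirical_Radon m (\<lambda>i. X i \<omega>) s y" for \<omega> s
  have h_eq: "h \<omega> s = - (Z (\<lambda>i. X i \<omega>) s / m)" if "s \<ge> 0" for \<omega> s
  proof -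
    have "Z (\<lambda>i. X i \<omega>) s
      = (\<Sum>i\<in>{1..m}. (if (norm (X i \<omega> - y))\<^sup>2 \<le> s\<^sup>2 then 1 else 0) - measure P (cball y s))"
      unfolding Z_def using that
      by (intro sum.cong) (auto simp: W_def mean_eq abs_le_square_iff[symmetric])
    also have "\<dots> = real (card {i \<in> {1..m}. (norm (X i \<omega> - y))\<^sup>2 \<le> s\<^sup>2}) - m * measure P (cball y s)"
      by (simp add: sum_subtractf sum.If_cases Int_def)
    finally show ?thesis
      using m by (simp add: h_def empirical_Radon_def diff_divide_distrib)
  qed
  \<comment> \<open>Outside \<open>[a, a + 2]\<close> the ball around \<open>y\<close> misses or covers the unit ball.\<close>
  have h_zero: "h \<omega> s = 0" if \<omega>: "\<omega> \<in> space M" and s: "s > 0" "s \<notin> {a..a + 2}" for \<omega> s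
  proof -
    have Xn: "norm (X i \<omega>) < 1" if "i \<in> {1..m}" for i
      using X_ball[OF that \<omega>] by simp
    consider "s + 1 < norm y" | "norm y + 1 < s"
      using s by (auto simp: a_def max_def split: if_splits)
    then show ?thesis
    proof cases
      case 1
      have far: "s < norm (x - y)" if "norm x < 1" for x
        using 1 that norm_triangle_ineq2[of y x] by (simp add: norm_minus_commute)
      have "cball y s \<inter> ball 0 1 = {}"
        using far by (auto simp: dist_norm norm_minus_commute not_le[symmetric])
      then have "measure P (cball y s) + measure P (ball 0 1) = measure P (cball y s \<union> ball 0 1)"
        by (intro P.finite_measure_Union[symmetric]) (auto simp: P_borel)
      then have "measure P (cball y s) = 0"
        using P.prob_le_1[of "cball y s \<union> ball 0 1"] P_ball measure_nonneg[of P "cball y s"] by linarith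
      moreover have "{i \<in> {1..m}. (norm (X i \<omega> - y))\<^sup>2 \<le> s\<^sup>2} = {}"
        using far Xn s by (auto simp: abs_le_square_iff[symmetric] not_le[symmetric])
      then have "empirical_Radon m (\<lambda>i. X i \<omega>) s y = 0"
        unfolding empirical_Radon_def by (simp only: card.empty)
      ultimately show ?thesis by (simp add: h_def)
    next
      case 2
      have near: "norm (x - y) \<le> s" if "norm x < 1" for x
        using 2 that norm_triangle_ineq4[of x y] by linarith
      have "ball 0 1 \<subseteq> cball y s"
        using near by (auto simp: dist_norm norm_minus_commute)
      then have "measure P (ball 0 1) \<le> measure P (cball y s)"
        by (intro P.finite_measure_mono) (auto simp: P_borel)
      then have "measure P (cball y s) = 1"
        using P.prob_le_1[of "cball y s"] P_ball by linarith
      moreover have "{i \<in> {1..m}. (norm (X i \<omega> - y))\<^sup>2 \<le> s\<^sup>2} = {1..m}"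
        using near Xn s by (auto simp: abs_le_square_iff[symmetric])
      then have "empirical_Radon m (\<lambda>i. X i \<omega>) s y = 1"
        unfolding empirical_Radon_def using m by simp
      ultimately show ?thesis by (simp add: h_def)
    qed
  qed
  have norm_le: "L2_pos_norm_sq (h \<omega>) \<le> ennreal ((L2 (Z (\<lambda>i. X i \<omega>)) / m)\<^sup>2)" if \<omega>: "\<omega> \<in> space M" for \<omega>
  proof -
    have bm: "bounded_meas (Z (\<lambda>i. X i \<omega>))"
      unfolding Z_def by (intro bounded_meas_sum bounded_meas_diff bounded_meas_W bounded_meas_mean) (simp add: space_P)
    have "L2_pos_norm_sq (h \<omega>) \<le> (\<integral>\<^sup>+ s. ennreal ((Z (\<lambda>i. X i \<omega>) s / m)\<^sup>2) * indicator {a..a + 2} s \<partial>lborel)"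
      unfolding L2_pos_norm_sq_def
    proof (rule nn_integral_mono)
      fix s
      show "ennreal ((h \<omega> s)\<^sup>2) * indicator {0<..} s \<le> ennreal ((Z (\<lambda>i. X i \<omega>) s / m)\<^sup>2) * indicator {a..a + 2} s"
        using h_zero[OF \<omega>, of s] h_eq[of s \<omega>] by (cases "s > 0"; cases "s \<in> {a..a + 2}") auto
    qed
    also have "\<dots> = (\<integral>\<^sup>+ s. ennreal ((Z (\<lambda>i. X i \<omega>) s / m)\<^sup>2) \<partial>N)"
      unfolding N_def by (simp add: nn_integral_restrict_space)
    also have "\<dots> = ennreal (LINT s|N. (Z (\<lambda>i. X i \<omega>) s / m)\<^sup>2)"
      using integrable_mult_bounded_meas(2)[OF bm bm]
      by (intro nn_integral_eq_integral) (auto simp: power_divide)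
    also have "(LINT s|N. (Z (\<lambda>i. X i \<omega>) s / m)\<^sup>2) = (L2 (Z (\<lambda>i. X i \<omega>)) / m)\<^sup>2"
      by (simp add: L2_sq power_divide)
    finally show ?thesis .
  qed
  let ?Q = "\<Pi>\<^sub>M i\<in>{1..m}. P"
  let ?E = "{x \<in> space ?Q. sqrt (t * m) \<le> L2 (Z x)}"
  have E: "?E \<in> sets ?Q"
    unfolding Z_def L2_def by measurable
  have sets_Q: "sets ?Q = sets (\<Pi>\<^sub>M i\<in>{1..m}. borel)"
    by (intro sets_PiM_cong) (auto simp: P_borel)
  have E_borel: "?E \<in> sets (\<Pi>\<^sub>M i\<in>{1..m}. borel)"
    using E unfolding sets_Q .
  have X_meas: "(\<lambda>\<omega>. \<lambda>i\<in>{1..m}. X i \<omega>) \<in> measurable M (\<Pi>\<^sub>M i\<in>{1..m}. borel)"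
    by (intro measurable_restrict X)
  have Z_restrict: "Z (\<lambda>i\<in>{1..m}. X i \<omega>) = Z (\<lambda>i. X i \<omega>)" for \<omega>
    by (simp add: Z_def fun_eq_iff)
  have "measure M {\<omega> \<in> space M. ennreal (t / m) < L2_pos_norm_sq (h \<omega>)}
    \<le> measure M ((\<lambda>\<omega>. \<lambda>i\<in>{1..m}. X i \<omega>) -` ?E \<inter> space M)"
  proof (rule M.finite_measure_mono)
    show "{\<omega> \<in> space M. ennreal (t / m) < L2_pos_norm_sq (h \<omega>)} \<subseteq> (\<lambda>\<omega>. \<lambda>i\<in>{1..m}. X i \<omega>) -` ?E \<inter> space M"
    proof
      fix \<omega> assume "\<omega> \<in> {\<omega> \<in> space M. ennreal (t / m) < L2_pos_norm_sq (h \<omega>)}"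
      then have \<omega>: "\<omega> \<in> space M" "ennreal (t / m) < L2_pos_norm_sq (h \<omega>)" by simp_all
      have "(\<lambda>i\<in>{1..m}. X i \<omega>) \<in> space ?Q" by (simp add: space_PiM space_P)
      moreover have "ennreal (t / m) < ennreal ((L2 (Z (\<lambda>i. X i \<omega>)) / m)\<^sup>2)"
        using \<omega> norm_le by (auto intro: less_le_trans)
      then have "t / m < (L2 (Z (\<lambda>i. X i \<omega>)) / m)\<^sup>2"
        using t by (simp add: ennreal_less_iff)
      then have "t * m < (L2 (Z (\<lambda>i. X i \<omega>)))\<^sup>2"
        using m by (simp add: field_simps power2_eq_square)
      then have "sqrt (t * m) \<le> L2 (Z (\<lambda>i\<in>{1..m}. X i \<omega>))"
        unfolding Z_restrict by (intro real_le_lsqrt) (use t in auto)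
      ultimately show "\<omega> \<in> (\<lambda>\<omega>. \<lambda>i\<in>{1..m}. X i \<omega>) -` ?E \<inter> space M"
        using \<omega>(1) by blast
    qed
    show "(\<lambda>\<omega>. \<lambda>i\<in>{1..m}. X i \<omega>) -` ?E \<inter> space M \<in> M.events"
      by (rule measurable_sets[OF X_meas E_borel])
  qed
  also have "\<dots> = measure ?Q ?E"
    using measure_distr[OF X_meas E_borel] by (simp only: X_iid)
  also have "\<dots> \<le> 2 * exp (- ((sqrt (t * m))\<^sup>2 / (2 * card {1..m} * (1 / sqrt 2)\<^sup>2)))"
    unfolding Z_def by (rule L2_hoeffding) (use t m in auto)
  also have "(sqrt (t * m))\<^sup>2 / (2 * card {1..m} * (1 / sqrt 2)\<^sup>2) = t"
    using t m by (simp add: power_divide)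
  finally show ?thesis by (simp only: h_def)
qed

theorem theorem6p3:
  fixes M :: "'w measure"
    and X :: "nat \<Rightarrow> 'w \<Rightarrow> real ^ 'n"
    and f :: "real ^ 'n \<Rightarrow> real"
    and y :: "nat \<Rightarrow> real ^ 'n"
    and m K :: nat
    and p :: real
  assumes "prob_space M"
    and "m \<ge> 1"
    and "smooth_compact_support_in f (ball 0 1)"
    and "\<And>x. f x \<ge> 0"
    and "\<And>i \<omega>. i \<in> {1..m} \<Longrightarrow> \<omega> \<in> space M \<Longrightarrow> X i \<omega> \<in> ball 0 1"
    and "prob_space.indep_vars M (\<lambda>_. borel) X {1..m}"
    and "\<And>i. i \<in> {1..m} \<Longrightarrow> distributed M lborel (X i) (\<lambda>x. ennreal (f x))"
    and "K \<ge> 1"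
    and "0 \<le> p" and "p \<le> 1"
  shows "measure M {\<omega> \<in> space M.
            ennreal (1 / real K) *
              (\<Sum>j = 1..K. L2_pos_norm_sq (\<lambda>s.
                 spherical_Radon f s (y j) - empirical_Radon m (\<lambda>i. X i \<omega>) s (y j)))
            \<le> (if p = 0 then \<infinity> else ennreal (1 / real m * (ln (real K) + ln (2 / p))))}
         \<ge> 1 - p"
proof (cases "p = 0")
  case True
  with prob_space.prob_space[OF assms(1)] show ?thesis by simp
next
  case False
  with assms have p: "p > 0" by simp
  interpret M: prob_space M by fact
  define t where "t = ln (real K) + ln (2 / p)"
  have t_eq: "t = ln (2 * K / p)" using p assms(8) by (simp add: t_def ln_div ln_mult)
  have "2 * real K / p > 1" using p assms(8,10) by (simp add: field_simps)
  then have t: "t > 0" by (simp add: t_eq)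
  have exp_t: "exp (- t) = p / (2 * K)"
    using p assms(8) by (simp add: t_eq exp_minus)

  have X: "X i \<in> borel_measurable M" if "i \<in> {1..m}" for i
    using distributed_measurable[OF assms(7)[OF that]] by simp
  define P where "P = density lborel (\<lambda>x. ennreal (f x))"
  have distr_X: "distr M borel (X i) = P" if "i \<in> {1..m}" for i
  proof -
    have "distr M borel (X i) = distr M lborel (X i)" by (rule distr_cong) simp_all
    then show ?thesis using distributed_distr_eq_density[OF assms(7)[OF that]] by (simp add: P_def)
  qed
  have one: "1 \<in> {1..m}" using assms(2) by simp
  have P_prob: "prob_space P"
    using M.prob_space_distr[OF X[OF one]] unfolding distr_X[OF one] .
  interpret P: prob_space P by fact
  have P_borel: "sets P = sets borel" by (simp add: P_def)
  have "measure (distr M borel (X 1)) (ball 0 1) = measure M (space M)"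
    using X[OF one] assms(5)[OF one] by (subst measure_distr) (auto intro!: arg_cong[of _ _ "measure M"])
  then have P_ball: "measure P (ball 0 1) = 1"
    by (simp only: distr_X[OF one] M.prob_space)
  have X_iid: "distr M (\<Pi>\<^sub>M i\<in>{1..m}. borel) (\<lambda>\<omega>. \<lambda>i\<in>{1..m}. X i \<omega>) = (\<Pi>\<^sub>M i\<in>{1..m}. P)"
  proof -
    have "distr M (\<Pi>\<^sub>M i\<in>{1..m}. borel) (\<lambda>\<omega>. \<lambda>i\<in>{1..m}. X i \<omega>) = (\<Pi>\<^sub>M i\<in>{1..m}. distr M borel (X i))"
      using assms(6) X one by (subst M.indep_vars_iff_distr_eq_PiM'[symmetric]) auto
    also have "\<dots> = (\<Pi>\<^sub>M i\<in>{1..m}. P)"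
      by (intro PiM_cong) (auto simp: distr_X)
    finally show ?thesis .
  qed

  have f_cont: "continuous_on UNIV f"
  proof -
    have "C_k 0 f" using assms(3) unfolding smooth_compact_support_in_def by blast
    then show ?thesis by simp
  qed
  then have f_meas [measurable]: "f \<in> borel_measurable borel"
    by (rule borel_measurable_continuous_onI)
  obtain B where B: "f x \<le> B" for x
  proof -
    let ?S = "closure {x. f x \<noteq> 0}"
    have "bounded (f ` ?S)"
      using assms(3) unfolding smooth_compact_support_in_def
      by (intro compact_imp_bounded compact_continuous_image continuous_on_subset[OF f_cont]) auto
    then obtain B where B: "\<And>x. x \<in> ?S \<Longrightarrow> \<bar>f x\<bar> \<le> B"
      by (auto simp: bounded_iff)
    have "f x \<le> max 0 B" for x
      using B[of x] closure_subset[of "{x. f x \<noteq> 0}"] by (cases "f x = 0") auto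
    then show ?thesis by (rule that)
  qed
  have fin: "(\<integral>\<^sup>+ x. f x \<partial>lborel) < \<infinity>"
    using P.emeasure_space_1 by (simp add: P_def emeasure_density)
  have Radon: "spherical_Radon f s z = measure P (cball z s)" for s z
  proof -
    have "ennreal (spherical_Radon f s z) = emeasure P (cball z s)"
      unfolding P_def using spherical_Radon_eq_nn_integral[OF f_meas assms(4) B fin]
      by (simp add: emeasure_density)
    moreover have "spherical_Radon f s z \<ge> 0"
      unfolding spherical_Radon_def set_lebesgue_integral_def
      by (intro Bochner_Integration.integral_nonneg) (auto simp: indicator_def assms(4))
    ultimately show ?thesis by (metis enn2real_ennreal measure_def)
  qed

  define D where "D j \<omega> = L2_pos_norm_sq (\<lambda>s. spherical_Radon f s (y j) - empirical_Radon m (\<lambda>i. X i \<omega>) s (y j))" for j \<omega>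
  have D_meas [measurable]: "D j \<in> borel_measurable M" for j
    unfolding D_def
  proof (rule L2_deviation_measurable[OF _ X])
    have "mono (\<lambda>s. measure P (cball (y j) s))"
      by (intro monoI P.finite_measure_mono) (auto simp: P_borel)
    then show "(\<lambda>s. spherical_Radon f s (y j)) \<in> borel_measurable borel"
      unfolding Radon by (rule borel_measurable_mono)
  qed
  have tail: "M.prob {\<omega> \<in> space M. ennreal (t / m) < D j \<omega>} \<le> p / K" for j
    unfolding D_def Radon
    using L2_deviation_tail[OF assms(1) P_prob P_borel P_ball assms(2) X assms(5) X_iid t, of "y j"]
    by (simp add: exp_t)
  let ?G = "{\<omega> \<in> space M. ennreal (1 / real K) * (\<Sum>j = 1..K. D j \<omega>) \<le> ennreal (t / m)}"
  \<comment> \<open>If the average over the centres exceeds \<open>t / m\<close>, then so does one of the terms.\<close>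
  have "space M - ?G \<subseteq> (\<Union>j\<in>{1..K}. {\<omega> \<in> space M. ennreal (t / m) < D j \<omega>})"
  proof
    fix \<omega> assume \<omega>: "\<omega> \<in> space M - ?G"
    show "\<omega> \<in> (\<Union>j\<in>{1..K}. {\<omega> \<in> space M. ennreal (t / m) < D j \<omega>})"
    proof (rule ccontr)
      assume "\<not> ?thesis"
      then have "(\<Sum>j = 1..K. D j \<omega>) \<le> (\<Sum>j = 1..K. ennreal (t / m))"
        using \<omega> by (intro sum_mono) (auto simp: not_less)
      then have "ennreal (1 / real K) * (\<Sum>j = 1..K. D j \<omega>) \<le> ennreal (1 / real K) * (of_nat K * ennreal (t / m))"
        by (intro mult_left_mono) simp_all
      also have "\<dots> = ennreal (t / m)"
        using assms(8) t by (simp add: ennreal_of_nat_eq_real_of_nat flip: ennreal_mult)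
      finally show False using \<omega> by auto
    qed
  qed
  then have "M.prob (space M - ?G) \<le> M.prob (\<Union>j\<in>{1..K}. {\<omega> \<in> space M. ennreal (t / m) < D j \<omega>})"
    by (intro M.finite_measure_mono) measurable
  also have "\<dots> \<le> (\<Sum>j\<in>{1..K}. M.prob {\<omega> \<in> space M. ennreal (t / m) < D j \<omega>})"
    by (intro M.finite_measure_subadditive_finite) auto
  also have "\<dots> \<le> (\<Sum>j\<in>{1..K}. p / K)" by (intro sum_mono tail)
  also have "\<dots> = p" using assms(8) by simp
  finally have "1 - p \<le> M.prob ?G"
    using M.prob_compl[of ?G] by simp
  then show ?thesis using False by (simp add: D_def t_def)
qed

end
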